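(* Let $A$ be a Frobenius algebra over a field $\Bbbk$ with respect to a non-degenerate associative bilinear form $\langle-,-\rangle$ that is symmetric, so that its Nakayama automorphism is $\sigma=\mathrm{id}_A$. (i) For all derivations $\delta:A\to A$ the element $\mathrm{div}_\sigma(\delta)$ is central in $A$. (ii) The map $\mathrm{div}_\sigma:\mathrm{Der}(A)\to Z(A)$ that we therefore have vanishes on inner derivations, so it induces a linear map $\mathrm{div}_\sigma:\mathrm{HH}^1(A)\to Z(A)$. The latter is a $1$-cocycle in the Chevalley–Eilenberg complex $\mathrm{CE}^*(\mathrm{HH}^1(A),Z(A))$, and so it gives rise to a cohomology class $\mathfrak{Div}(A)$ in the Lie algebra cohomology $H^1(\mathrm{HH}^1(A),Z(A))$ of $\mathrm{HH}^1(A)$ with values in $Z(A)$.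
   Context: $\Bbbk$ is a field; algebras are associative and unital over $\Bbbk$, and derivations are $\Bbbk$-linear. A Frobenius algebra is a finite-dimensional algebra $A$ endowed with a non-degenerate bilinear form $\langle-,-\rangle:A\times A\to\Bbbk$ that is associative: $\langle ab,c\rangle=\langle a,bc\rangle$ for all $a,b,c\in A$. Its Nakayama automorphism is the unique algebra automorphism $\sigma:A\to A$ such that $\langle a,b\rangle=\langle b,\sigma(a)\rangle$ for all $a,b\in A$. The Nakayama divergence of a derivation $\delta:A\to A$ is the unique element $\mathrm{div}_\sigma(\delta)\in A$ such that $\langle\delta(a),b\rangle+\langle a,\delta(b)\rangle=\langle a,b\cdot\mathrm{div}_\sigma(\delta)\rangle$ for all $a,b\in A$. $Z(A)$ is the center of $A$, $\mathrm{Der}(A)$ the Lie algebra of derivations of $A$ under the commutator, $\mathrm{InnDer}(A)$ the ideal of inner derivations $a\mapsto xa-ax$, and $\mathrm{HH}^1(A)=\mathrm{Der}(A)/\mathrm{InnDer}(A)$, a Lie algebra that acts on $Z(A)$ by evaluating derivations. A $1$-cocycle of a Lie algebra $\mathfrak g$ with values in a $\mathfrak g$-module $M$ is a linear map $f:\mathfrak g\to M$ with $f([x,y])=x\cdot f(y)-y\cdot f(x)$. *)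

theory Defs
  imports Complex_Main
begin

section \<open>Algebras and Frobenius algebras\<close>

text \<open>The sort \<open>{ring, monoid_mult}\<close> is that of associative unital rings; unlike
  \<open>ring_1\<close> it does not exclude the zero ring.\<close>

locale unital_algebra = vector_space scale
  for scale :: "'k::field \<Rightarrow> 'a::{ring, monoid_mult} \<Rightarrow> 'a" +
  assumes scale_mult_left: "scale c a * b = scale c (a * b)"
    and scale_mult_right: "a * scale c b = scale c (a * b)"

locale frobenius_algebra = unital_algebra scale
  for scale :: "'k::field \<Rightarrow> 'a::{ring, monoid_mult} \<Rightarrow> 'a"
    and form :: "'a \<Rightarrow> 'a \<Rightarrow> 'k" +
  assumes finite_dimensional: "\<exists>B. finite B \<and> module.span scale B = UNIV"
    and form_linear_left: "Vector_Spaces.linear scale (*) (\<lambda>a. form a b)"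
    and form_linear_right: "Vector_Spaces.linear scale (*) (\<lambda>b. form a b)"
    and form_nondegenerate_left: "(\<And>b. form a b = 0) \<Longrightarrow> a = 0"
    and form_nondegenerate_right: "(\<And>a. form a b = 0) \<Longrightarrow> b = 0"
    and form_assoc: "form (a * b) c = form a (b * c)"

definition algebra_automorphism ::
    "('k::field \<Rightarrow> 'a::{ring, monoid_mult} \<Rightarrow> 'a) \<Rightarrow> ('a \<Rightarrow> 'a) \<Rightarrow> bool" where
  "algebra_automorphism scale \<sigma> \<longleftrightarrow>
     Vector_Spaces.linear scale scale \<sigma> \<and> bij \<sigma> \<and> \<sigma> 1 = 1 \<and> (\<forall>a b. \<sigma> (a * b) = \<sigma> a * \<sigma> b)"

definition nakayama_automorphism ::
    "('k::field \<Rightarrow> 'a::{ring, monoid_mult} \<Rightarrow> 'a) \<Rightarrow> ('a \<Rightarrow> 'a \<Rightarrow> 'k) \<Rightarrow> 'a \<Rightarrow> 'a" where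
  "nakayama_automorphism scale form =
     (THE \<sigma>. algebra_automorphism scale \<sigma> \<and> (\<forall>a b. form a b = form b (\<sigma> a)))"

definition center :: "'a::{ring, monoid_mult} set" where
  "center = {z. \<forall>a. z * a = a * z}"

definition Der :: "('k::field \<Rightarrow> 'a::{ring, monoid_mult} \<Rightarrow> 'a) \<Rightarrow> ('a \<Rightarrow> 'a) set" where
  "Der scale = {\<delta>. Vector_Spaces.linear scale scale \<delta> \<and> (\<forall>a b. \<delta> (a * b) = \<delta> a * b + a * \<delta> b)}"

definition InnDer :: "('a::{ring, monoid_mult} \<Rightarrow> 'a) set" where
  "InnDer = {\<delta>. \<exists>x. \<delta> = (\<lambda>a. x * a - a * x)}"

definition nakayama_div ::
    "('a::{ring, monoid_mult} \<Rightarrow> 'a \<Rightarrow> 'k::field) \<Rightarrow> ('a \<Rightarrow> 'a) \<Rightarrow> 'a" where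
  "nakayama_div form \<delta> = (THE d. \<forall>a b. form (\<delta> a) b + form a (\<delta> b) = form a (b * d))"


section \<open>Lie algebras, quotients and modules\<close>

record ('k, 'g) lie_struct =
  lcarrier :: "'g set"
  lzero :: 'g
  ladd :: "'g \<Rightarrow> 'g \<Rightarrow> 'g"
  lsmult :: "'k \<Rightarrow> 'g \<Rightarrow> 'g"
  lbracket :: "'g \<Rightarrow> 'g \<Rightarrow> 'g"

locale lie_algebra =
  fixes L :: "('k::field, 'g) lie_struct"
  assumes zero_closed: "lzero L \<in> lcarrier L"
    and add_closed: "x \<in> lcarrier L \<Longrightarrow> y \<in> lcarrier L \<Longrightarrow> ladd L x y \<in> lcarrier L"
    and smult_closed: "x \<in> lcarrier L \<Longrightarrow> lsmult L c x \<in> lcarrier L"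
    and bracket_closed: "x \<in> lcarrier L \<Longrightarrow> y \<in> lcarrier L \<Longrightarrow> lbracket L x y \<in> lcarrier L"
    and add_assoc: "x \<in> lcarrier L \<Longrightarrow> y \<in> lcarrier L \<Longrightarrow> z \<in> lcarrier L \<Longrightarrow>
      ladd L (ladd L x y) z = ladd L x (ladd L y z)"
    and add_comm: "x \<in> lcarrier L \<Longrightarrow> y \<in> lcarrier L \<Longrightarrow> ladd L x y = ladd L y x"
    and add_zero: "x \<in> lcarrier L \<Longrightarrow> ladd L x (lzero L) = x"
    and add_inverse: "x \<in> lcarrier L \<Longrightarrow> \<exists>y\<in>lcarrier L. ladd L x y = lzero L"
    and smult_add: "x \<in> lcarrier L \<Longrightarrow> y \<in> lcarrier L \<Longrightarrow>
      lsmult L c (ladd L x y) = ladd L (lsmult L c x) (lsmult L c y)"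
    and add_smult: "x \<in> lcarrier L \<Longrightarrow>
      lsmult L (c + d) x = ladd L (lsmult L c x) (lsmult L d x)"
    and smult_smult: "x \<in> lcarrier L \<Longrightarrow> lsmult L c (lsmult L d x) = lsmult L (c * d) x"
    and smult_one: "x \<in> lcarrier L \<Longrightarrow> lsmult L 1 x = x"
    and bracket_add_left: "x \<in> lcarrier L \<Longrightarrow> y \<in> lcarrier L \<Longrightarrow> z \<in> lcarrier L \<Longrightarrow>
      lbracket L (ladd L x y) z = ladd L (lbracket L x z) (lbracket L y z)"
    and bracket_add_right: "x \<in> lcarrier L \<Longrightarrow> y \<in> lcarrier L \<Longrightarrow> z \<in> lcarrier L \<Longrightarrow>
      lbracket L x (ladd L y z) = ladd L (lbracket L x y) (lbracket L x z)"
    and bracket_smult_left: "x \<in> lcarrier L \<Longrightarrow> y \<in> lcarrier L \<Longrightarrow>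
      lbracket L (lsmult L c x) y = lsmult L c (lbracket L x y)"
    and bracket_smult_right: "x \<in> lcarrier L \<Longrightarrow> y \<in> lcarrier L \<Longrightarrow>
      lbracket L x (lsmult L c y) = lsmult L c (lbracket L x y)"
    and bracket_self: "x \<in> lcarrier L \<Longrightarrow> lbracket L x x = lzero L"
    and jacobi: "x \<in> lcarrier L \<Longrightarrow> y \<in> lcarrier L \<Longrightarrow> z \<in> lcarrier L \<Longrightarrow>
      ladd L (lbracket L x (lbracket L y z))
        (ladd L (lbracket L y (lbracket L z x)) (lbracket L z (lbracket L x y))) = lzero L"

definition lcoset :: "('k, 'g) lie_struct \<Rightarrow> 'g set \<Rightarrow> 'g \<Rightarrow> 'g set" where
  "lcoset L I x = (\<lambda>i. ladd L x i) ` I"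

text \<open>Operations on cosets are unions over all representatives; if \<open>I\<close> is an ideal, all the
  cosets in such a union coincide.\<close>

definition lie_quotient :: "('k, 'g) lie_struct \<Rightarrow> 'g set \<Rightarrow> ('k, 'g set) lie_struct" where
  "lie_quotient L I =
    \<lparr> lcarrier = lcoset L I ` lcarrier L,
      lzero = lcoset L I (lzero L),
      ladd = (\<lambda>X Y. \<Union>x\<in>X. \<Union>y\<in>Y. lcoset L I (ladd L x y)),
      lsmult = (\<lambda>c X. \<Union>x\<in>X. lcoset L I (lsmult L c x)),
      lbracket = (\<lambda>X Y. \<Union>x\<in>X. \<Union>y\<in>Y. lcoset L I (lbracket L x y)) \<rparr>"

text \<open>The underlying space of a module is a subspace \<open>M\<close> of a vector space given by
  a type and \<open>scale\<close>.\<close>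

locale lie_module = lie_algebra L + vector_space scale
  for L :: "('k::field, 'g) lie_struct"
    and scale :: "'k \<Rightarrow> 'm::ab_group_add \<Rightarrow> 'm" +
  fixes M :: "'m set" and act :: "'g \<Rightarrow> 'm \<Rightarrow> 'm"
  assumes subspace: "module.subspace scale M"
    and act_closed: "x \<in> lcarrier L \<Longrightarrow> m \<in> M \<Longrightarrow> act x m \<in> M"
    and act_add: "x \<in> lcarrier L \<Longrightarrow> m \<in> M \<Longrightarrow> n \<in> M \<Longrightarrow> act x (m + n) = act x m + act x n"
    and act_scale: "x \<in> lcarrier L \<Longrightarrow> m \<in> M \<Longrightarrow> act x (scale c m) = scale c (act x m)"
    and add_act: "x \<in> lcarrier L \<Longrightarrow> y \<in> lcarrier L \<Longrightarrow> m \<in> M \<Longrightarrow>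
      act (ladd L x y) m = act x m + act y m"
    and smult_act: "x \<in> lcarrier L \<Longrightarrow> m \<in> M \<Longrightarrow> act (lsmult L c x) m = scale c (act x m)"
    and bracket_act: "x \<in> lcarrier L \<Longrightarrow> y \<in> lcarrier L \<Longrightarrow> m \<in> M \<Longrightarrow>
      act (lbracket L x y) m = act x (act y m) - act y (act x m)"

definition lie_linear ::
    "('k::field, 'g) lie_struct \<Rightarrow> ('k \<Rightarrow> 'm::ab_group_add \<Rightarrow> 'm) \<Rightarrow> 'm set \<Rightarrow> ('g \<Rightarrow> 'm) \<Rightarrow> bool" where
  "lie_linear L scale M f \<longleftrightarrow>
     (\<forall>x\<in>lcarrier L. f x \<in> M) \<and>
     (\<forall>x\<in>lcarrier L. \<forall>y\<in>lcarrier L. f (ladd L x y) = f x + f y) \<and>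
     (\<forall>c. \<forall>x\<in>lcarrier L. f (lsmult L c x) = scale c (f x))"

definition lie_1_cocycle ::
    "('k::field, 'g) lie_struct \<Rightarrow> ('k \<Rightarrow> 'm::ab_group_add \<Rightarrow> 'm) \<Rightarrow> 'm set \<Rightarrow>
     ('g \<Rightarrow> 'm \<Rightarrow> 'm) \<Rightarrow> ('g \<Rightarrow> 'm) \<Rightarrow> bool" where
  "lie_1_cocycle L scale M act f \<longleftrightarrow>
     lie_linear L scale M f \<and>
     (\<forall>x\<in>lcarrier L. \<forall>y\<in>lcarrier L. f (lbracket L x y) = act x (f y) - act y (f x))"


section \<open>The Chevalley--Eilenberg complex\<close>

text \<open>An \<open>n\<close>-cochain is an alternating multilinear map of \<open>n\<close> arguments from the Lie algebra
  to \<open>M\<close>, encoded as a function on lists that is \<open>0\<close> outside the lists of length \<open>n\<close> over the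
  carrier, so that equal cochains are equal functions.\<close>

definition CE_cochains ::
    "('k::field, 'g) lie_struct \<Rightarrow> ('k \<Rightarrow> 'm::ab_group_add \<Rightarrow> 'm) \<Rightarrow> 'm set \<Rightarrow> nat \<Rightarrow>
     ('g list \<Rightarrow> 'm) set" where
  "CE_cochains L scale M n = {\<omega>.
     (\<forall>xs. \<not> (length xs = n \<and> set xs \<subseteq> lcarrier L) \<longrightarrow> \<omega> xs = 0) \<and>
     (\<forall>xs. length xs = n \<longrightarrow> set xs \<subseteq> lcarrier L \<longrightarrow>
        \<omega> xs \<in> M \<and>
        (\<forall>i<n. lie_linear L scale M (\<lambda>x. \<omega> (xs[i := x]))) \<and>
        (\<forall>i j. i < j \<longrightarrow> j < n \<longrightarrow> xs ! i = xs ! j \<longrightarrow> \<omega> xs = 0))}"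

text \<open>\<open>nths xs (- {i, j})\<close> is the list \<open>xs\<close> with the entries at positions \<open>i\<close> and \<open>j\<close> omitted.\<close>

definition CE_d ::
    "('k::field, 'g) lie_struct \<Rightarrow> ('k \<Rightarrow> 'm::ab_group_add \<Rightarrow> 'm) \<Rightarrow> ('g \<Rightarrow> 'm \<Rightarrow> 'm) \<Rightarrow>
     ('g list \<Rightarrow> 'm) \<Rightarrow> 'g list \<Rightarrow> 'm" where
  "CE_d L scale act \<omega> xs =
     (if set xs \<subseteq> lcarrier L then
        (\<Sum>i<length xs. scale ((-1) ^ i) (act (xs ! i) (\<omega> (nths xs (- {i}))))) +
        (\<Sum>j<length xs. \<Sum>i<j.
           scale ((-1) ^ (i + j)) (\<omega> (lbracket L (xs ! i) (xs ! j) # nths xs (- {i, j}))))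
      else 0)"

definition CE_cocycles ::
    "('k::field, 'g) lie_struct \<Rightarrow> ('k \<Rightarrow> 'm::ab_group_add \<Rightarrow> 'm) \<Rightarrow> 'm set \<Rightarrow> ('g \<Rightarrow> 'm \<Rightarrow> 'm) \<Rightarrow>
     nat \<Rightarrow> ('g list \<Rightarrow> 'm) set" where
  "CE_cocycles L scale M act n = {\<omega> \<in> CE_cochains L scale M n. CE_d L scale act \<omega> = (\<lambda>_. 0)}"

definition CE_coboundaries ::
    "('k::field, 'g) lie_struct \<Rightarrow> ('k \<Rightarrow> 'm::ab_group_add \<Rightarrow> 'm) \<Rightarrow> 'm set \<Rightarrow> ('g \<Rightarrow> 'm \<Rightarrow> 'm) \<Rightarrow>
     nat \<Rightarrow> ('g list \<Rightarrow> 'm) set" where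
  "CE_coboundaries L scale M act n =
     (case n of 0 \<Rightarrow> {\<lambda>_. 0} | Suc p \<Rightarrow> CE_d L scale act ` CE_cochains L scale M p)"

definition CE_class ::
    "('k::field, 'g) lie_struct \<Rightarrow> ('k \<Rightarrow> 'm::ab_group_add \<Rightarrow> 'm) \<Rightarrow> 'm set \<Rightarrow> ('g \<Rightarrow> 'm \<Rightarrow> 'm) \<Rightarrow>
     nat \<Rightarrow> ('g list \<Rightarrow> 'm) \<Rightarrow> ('g list \<Rightarrow> 'm) set" where
  "CE_class L scale M act n \<omega> = {\<lambda>xs. \<omega> xs + \<beta> xs |\<beta>. \<beta> \<in> CE_coboundaries L scale M act n}"

definition CE_cohomology ::
    "('k::field, 'g) lie_struct \<Rightarrow> ('k \<Rightarrow> 'm::ab_group_add \<Rightarrow> 'm) \<Rightarrow> 'm set \<Rightarrow> ('g \<Rightarrow> 'm \<Rightarrow> 'm) \<Rightarrow>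
     nat \<Rightarrow> ('g list \<Rightarrow> 'm) set set" where
  "CE_cohomology L scale M act n = CE_class L scale M act n ` CE_cocycles L scale M act n"

definition CE_1_cochain :: "('k, 'g) lie_struct \<Rightarrow> ('g \<Rightarrow> 'm::zero) \<Rightarrow> 'g list \<Rightarrow> 'm" where
  "CE_1_cochain L f xs = (case xs of [x] \<Rightarrow> if x \<in> lcarrier L then f x else 0 | _ \<Rightarrow> 0)"


section \<open>The first Hochschild cohomology and the divergence class\<close>

definition Der_lie ::
    "('k::field \<Rightarrow> 'a::{ring, monoid_mult} \<Rightarrow> 'a) \<Rightarrow> ('k, 'a \<Rightarrow> 'a) lie_struct" where
  "Der_lie scale =
    \<lparr> lcarrier = Der scale,
      lzero = (\<lambda>_. 0),
      ladd = (\<lambda>\<delta> \<epsilon> a. \<delta> a + \<epsilon> a),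
      lsmult = (\<lambda>c \<delta> a. scale c (\<delta> a)),
      lbracket = (\<lambda>\<delta> \<epsilon> a. \<delta> (\<epsilon> a) - \<epsilon> (\<delta> a)) \<rparr>"

definition HH1 ::
    "('k::field \<Rightarrow> 'a::{ring, monoid_mult} \<Rightarrow> 'a) \<Rightarrow> ('k, ('a \<Rightarrow> 'a) set) lie_struct" where
  "HH1 scale = lie_quotient (Der_lie scale) InnDer"

definition HH1_class ::
    "('k::field \<Rightarrow> 'a::{ring, monoid_mult} \<Rightarrow> 'a) \<Rightarrow> ('a \<Rightarrow> 'a) \<Rightarrow> ('a \<Rightarrow> 'a) set" where
  "HH1_class scale \<delta> = lcoset (Der_lie scale) InnDer \<delta>"

text \<open>The next two maps take the common value at all representatives of a class.\<close>

definition HH1_act :: "('a \<Rightarrow> 'a) set \<Rightarrow> 'a \<Rightarrow> 'a" where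
  "HH1_act X z = the_elem ((\<lambda>\<delta>. \<delta> z) ` X)"

definition HH1_div ::
    "('a::{ring, monoid_mult} \<Rightarrow> 'a \<Rightarrow> 'k::field) \<Rightarrow> ('a \<Rightarrow> 'a) set \<Rightarrow> 'a" where
  "HH1_div form X = the_elem (nakayama_div form ` X)"

definition Div_class ::
    "('k::field \<Rightarrow> 'a::{ring, monoid_mult} \<Rightarrow> 'a) \<Rightarrow> ('a \<Rightarrow> 'a \<Rightarrow> 'k) \<Rightarrow>
     (('a \<Rightarrow> 'a) set list \<Rightarrow> 'a) set" where
  "Div_class scale form =
     CE_class (HH1 scale) scale center HH1_act 1 (CE_1_cochain (HH1 scale) (HH1_div form))"


section \<open>Well-definedness\<close>

context frobenius_algebra
begin

lemma form_simps:
  "form (a + b) c = form a c + form b c" "form a (b + c) = form a b + form a c"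
  "form (a - b) c = form a c - form b c" "form a (b - c) = form a b - form a c"
  "form (scale r a) c = r * form a c" "form a (scale r c) = r * form a c"
  "form 0 c = 0" "form a 0 = 0"
proof -
  interpret l: Vector_Spaces.linear scale "(*)" "\<lambda>a. form a c" for c by (rule form_linear_left)
  interpret r: Vector_Spaces.linear scale "(*)" "form a" for a by (rule form_linear_right)
  show "form (a + b) c = form a c + form b c" by (rule l.add)
  show "form a (b + c) = form a b + form a c" by (rule r.add)
  show "form (a - b) c = form a c - form b c" by (rule l.diff)
  show "form a (b - c) = form a b - form a c" by (rule r.diff)
  show "form (scale r a) c = r * form a c" by (rule l.scale)
  show "form a (scale r c) = r * form a c" by (rule r.scale)
  show "form 0 c = 0" by (rule l.zero)
  show "form a 0 = 0" by (rule r.zero)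
qed

lemma form_right_cancel:
  assumes "\<And>a. form a c = form a d" shows "c = d"
  using form_nondegenerate_right[of "c - d"] assms by (simp add: form_simps)

lemma form_represents:
  assumes "Vector_Spaces.linear scale (*) \<phi>"
  shows "\<exists>!d. \<forall>a. form a d = \<phi> a"
proof -
  obtain B0 where B0: "finite B0" "span B0 = UNIV" using finite_dimensional by blast
  obtain B where B: "B \<subseteq> B0" "independent B" "B0 \<subseteq> span B"
    using maximal_independent_subset[of B0] by auto
  have fin: "finite B" using B(1) B0(1) finite_subset by blast
  have sp: "span B = UNIV"
    using B(3) B0(2) span_mono[OF B(3)] by (simp add: span_span top.extremum_unique)
  interpret fd: finite_dimensional_vector_space scale B
    by unfold_locales (use fin B(2) sp in auto)
  interpret f: Vector_Spaces.linear scale "(*)" \<phi> by fact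
  interpret l: Vector_Spaces.linear scale "(*)" "\<lambda>a. form a c" for c by (rule form_linear_left)
  have coord: "\<forall>b\<in>B. u b = v b" if "(\<Sum>b\<in>B. scale (u b) b) = (\<Sum>b\<in>B. scale (v b) b)" for u v
  proof -
    have "(\<Sum>b\<in>B. scale (u b - v b) b) = 0"
      using that by (simp add: scale_left_diff_distrib sum_subtractf)
    then show ?thesis
      using independentD[OF B(2) fin order_refl, of "\<lambda>b. u b - v b"] by auto
  qed
  have agree: "\<forall>a. form a d = \<psi> a"
    if lin: "Vector_Spaces.linear scale (*) \<psi>" and "\<forall>b\<in>B. form b d = \<psi> b" for d \<psi>
  proof
    fix a
    interpret p: vector_space_pair scale "(*)" by unfold_locales (auto simp: algebra_simps)
    show "form a d = \<psi> a"
      using p.linear_eq_on[OF form_linear_left lin, of a B d] that sp by auto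
  qed
  define T where "T d = (\<Sum>b\<in>B. scale (form b d) b)" for d
  have T: "Vector_Spaces.linear scale scale T"
    by unfold_locales
      (auto simp: T_def form_simps scale_left_distrib sum.distrib scale_sum_right)
  have "inj T"
  proof (rule injI)
    fix c d assume "T c = T d"
    then have "\<forall>b\<in>B. form b c = form b d" unfolding T_def by (rule coord)
    then show "c = d" using agree[OF form_linear_left, of c d] by (intro form_right_cancel) auto
  qed
  then have "surj T" using fd.linear_inj_imp_surj[OF T] by blast
  then obtain d where "T d = (\<Sum>b\<in>B. scale (\<phi> b) b)" by (metis surj_def)
  then have "\<forall>b\<in>B. form b d = \<phi> b" unfolding T_def by (rule coord)
  then have "\<forall>a. form a d = \<phi> a" using agree[OF assms] by blast
  then show ?thesis using form_right_cancel by metis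
qed

lemma nakayama_div_ex1:
  assumes "\<delta> \<in> Der scale"
  shows "\<exists>!d. \<forall>a b. form (\<delta> a) b + form a (\<delta> b) = form a (b * d)"
proof -
  have D: "Vector_Spaces.linear scale scale \<delta>" "\<And>a b. \<delta> (a * b) = \<delta> a * b + a * \<delta> b"
    using assms by (auto simp: Der_def)
  have one: "form a b = form (a * b) 1" for a b by (simp add: form_assoc)
  have eq: "form (\<delta> a) b + form a (\<delta> b) = form (\<delta> (a * b)) 1" for a b
    using one[of "\<delta> a" b] one[of a "\<delta> b"] by (simp add: D form_simps)
  have "Vector_Spaces.linear scale (*) (\<lambda>a. form (\<delta> a) 1)"
    using Vector_Spaces.linear_compose[OF D(1) form_linear_left] by (simp add: o_def)
  from form_represents[OF this] obtain d where d: "\<And>a. form a d = form (\<delta> a) 1" by blast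
  show ?thesis
  proof (rule ex1I[of _ d])
    show "\<forall>a b. form (\<delta> a) b + form a (\<delta> b) = form a (b * d)"
      by (simp add: eq d flip: form_assoc)
    fix e assume "\<forall>a b. form (\<delta> a) b + form a (\<delta> b) = form a (b * e)"
    then have "form a e = form a d" for a
      using eq[of a 1] d[of a] by (metis mult_1 mult_1_right)
    then show "e = d" by (rule form_right_cancel)
  qed
qed

lemma nakayama_automorphism_ex1:
  "\<exists>!\<sigma>. algebra_automorphism scale \<sigma> \<and> (\<forall>a b. form a b = form b (\<sigma> a))"
proof -
  have "\<forall>a. \<exists>d. \<forall>b. form b d = form a b"
    using form_represents[OF form_linear_right] by blast
  then obtain \<sigma> where \<sigma>: "\<And>a b. form b (\<sigma> a) = form a b" by metis
  have lin: "Vector_Spaces.linear scale scale \<sigma>"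
    by unfold_locales (auto intro!: form_right_cancel simp: \<sigma> form_simps)
  have mult: "\<sigma> (a * b) = \<sigma> a * \<sigma> b" for a b
    by (rule form_right_cancel) (metis \<sigma> form_assoc)
  have one: "\<sigma> 1 = 1"
    by (rule form_right_cancel) (metis \<sigma> form_assoc mult_1 mult_1_right)
  have "inj \<sigma>"
  proof (rule injI)
    fix a c assume "\<sigma> a = \<sigma> c"
    then have "form (a - c) b = 0" for b using \<sigma>[of b a] \<sigma>[of b c] by (simp add: form_simps)
    then show "a = c" using form_nondegenerate_left[of "a - c"] by simp
  qed
  moreover have "surj \<sigma>"
  proof -
    obtain B0 where B0: "finite B0" "span B0 = UNIV" using finite_dimensional by blast
    obtain B where B: "B \<subseteq> B0" "independent B" "B0 \<subseteq> span B"
      using maximal_independent_subset[of B0] by auto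
    interpret fd: finite_dimensional_vector_space scale B
      by unfold_locales
        (use B B0 span_mono[OF B(3)] in
          \<open>auto simp: span_span intro: finite_subset\<close>)
    show ?thesis using fd.linear_inj_imp_surj[OF lin \<open>inj \<sigma>\<close>] .
  qed
  ultimately have "algebra_automorphism scale \<sigma>"
    unfolding algebra_automorphism_def bij_def using lin mult one by blast
  show ?thesis
  proof (rule ex1I[of _ \<sigma>])
    show "algebra_automorphism scale \<sigma> \<and> (\<forall>a b. form a b = form b (\<sigma> a))"
      using \<open>algebra_automorphism scale \<sigma>\<close> \<sigma> by simp
    fix \<tau> assume "algebra_automorphism scale \<tau> \<and> (\<forall>a b. form a b = form b (\<tau> a))"
    then have "\<tau> a = \<sigma> a" for a by (intro form_right_cancel) (metis \<sigma>)
    then show "\<tau> = \<sigma>" by blast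
  qed
qed

end

lemma (in lie_algebra) quotient_lie_algebra:
  assumes sub: "I \<subseteq> lcarrier L" and zero: "lzero L \<in> I"
    and add: "\<And>i j. i \<in> I \<Longrightarrow> j \<in> I \<Longrightarrow> ladd L i j \<in> I"
    and inv: "\<And>i. i \<in> I \<Longrightarrow> \<exists>j\<in>I. ladd L i j = lzero L"
    and smult: "\<And>c i. i \<in> I \<Longrightarrow> lsmult L c i \<in> I"
    and br: "\<And>x i. x \<in> lcarrier L \<Longrightarrow> i \<in> I \<Longrightarrow> lbracket L x i \<in> I \<and> lbracket L i x \<in> I"
  shows "lie_algebra (lie_quotient L I)"
    and "\<And>x y. x \<in> lcarrier L \<Longrightarrow> y \<in> lcarrier L \<Longrightarrow>
      ladd (lie_quotient L I) (lcoset L I x) (lcoset L I y) = lcoset L I (ladd L x y)"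
    and "\<And>c x. x \<in> lcarrier L \<Longrightarrow>
      lsmult (lie_quotient L I) c (lcoset L I x) = lcoset L I (lsmult L c x)"
    and "\<And>x y. x \<in> lcarrier L \<Longrightarrow> y \<in> lcarrier L \<Longrightarrow>
      lbracket (lie_quotient L I) (lcoset L I x) (lcoset L I y) = lcoset L I (lbracket L x y)"
proof -
  let ?Q = "lie_quotient L I" and ?p = "lcoset L I"
  note cl = zero_closed add_closed smult_closed bracket_closed
  have iL: "i \<in> lcarrier L" if "i \<in> I" for i using that sub by blast
  have shift: "?p (ladd L x i) = ?p x" if x: "x \<in> lcarrier L" and i: "i \<in> I" for x i
  proof -
    obtain j where j: "j \<in> I" "ladd L i j = lzero L" using inv i by blast
    have s1: "ladd L (ladd L x i) k = ladd L x (ladd L i k)" if "k \<in> I" for k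
      using add_assoc x i that iL by blast
    have s2: "ladd L x k = ladd L (ladd L x i) (ladd L j k)" if k: "k \<in> I" for k
    proof -
      have "ladd L (ladd L x i) (ladd L j k) = ladd L x (ladd L (ladd L i j) k)"
        using x i j(1) k iL by (simp add: add_assoc cl)
      also have "\<dots> = ladd L x k"
        using j(2) k iL by (metis add_comm add_zero zero_closed)
      finally show ?thesis by simp
    qed
    show ?thesis
      unfolding lcoset_def
    proof (intro equalityI image_subsetI)
      fix k assume k: "k \<in> I"
      show "ladd L (ladd L x i) k \<in> ladd L x ` I"
        unfolding s1[OF k] using add[OF i k] by (rule imageI)
      show "ladd L x k \<in> ladd L (ladd L x i) ` I"
        unfolding s2[OF k] using add[OF j(1) k] by (rule imageI)
    qed
  qed
  have rep: "\<exists>i\<in>I. y = ladd L x i" if "y \<in> ?p x" for x y using that by (auto simp: lcoset_def)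
  have self: "x \<in> ?p x" if "x \<in> lcarrier L" for x
    using zero add_zero[OF that] unfolding lcoset_def by (metis image_eqI)
  have swap: "ladd L (ladd L x i) (ladd L y j) = ladd L (ladd L x y) (ladd L i j)"
    if "x \<in> lcarrier L" "i \<in> lcarrier L" "y \<in> lcarrier L" "j \<in> lcarrier L" for x i y j
    using that by (smt (verit) add_assoc add_comm add_closed)
  show A: "ladd ?Q (?p x) (?p y) = ?p (ladd L x y)"
    if x: "x \<in> lcarrier L" and y: "y \<in> lcarrier L" for x y
  proof -
    have "?p (ladd L u v) = ?p (ladd L x y)" if uv: "u \<in> ?p x" "v \<in> ?p y" for u v
    proof -
      obtain i j where ij: "i \<in> I" "j \<in> I" "u = ladd L x i" "v = ladd L y j"
        using rep[OF uv(1)] rep[OF uv(2)] by blast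
      show ?thesis
        unfolding ij(3,4) swap[OF x iL[OF ij(1)] y iL[OF ij(2)]]
        by (rule shift[OF add_closed[OF x y] add[OF ij(1,2)]])
    qed
    then have "(\<Union>u\<in>?p x. \<Union>v\<in>?p y. ?p (ladd L u v)) = ?p (ladd L x y)"
      using self[OF x] self[OF y] by blast
    then show ?thesis by (simp add: lie_quotient_def)
  qed
  show S: "lsmult ?Q c (?p x) = ?p (lsmult L c x)" if x: "x \<in> lcarrier L" for c x
  proof -
    have "?p (lsmult L c u) = ?p (lsmult L c x)" if "u \<in> ?p x" for u
      using rep[OF that] x by (auto simp: smult_add iL shift cl smult)
    then have "(\<Union>u\<in>?p x. ?p (lsmult L c u)) = ?p (lsmult L c x)"
      using self[OF x] by blast
    then show ?thesis by (simp add: lie_quotient_def)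
  qed
  show B: "lbracket ?Q (?p x) (?p y) = ?p (lbracket L x y)"
    if x: "x \<in> lcarrier L" and y: "y \<in> lcarrier L" for x y
  proof -
    have "?p (lbracket L u v) = ?p (lbracket L x y)" if uv: "u \<in> ?p x" "v \<in> ?p y" for u v
    proof -
      obtain i j where ij: "i \<in> I" "j \<in> I" "u = ladd L x i" "v = ladd L y j"
        using rep[OF uv(1)] rep[OF uv(2)] by blast
      have "?p (lbracket L u v) = ?p (lbracket L u y)"
        using ij x y br[of u j] by (simp add: bracket_add_right shift cl iL)
      also have "\<dots> = ?p (lbracket L x y)"
        using ij x y br[of y i] by (simp add: bracket_add_left shift cl iL)
      finally show ?thesis .
    qed
    then have "(\<Union>u\<in>?p x. \<Union>v\<in>?p y. ?p (lbracket L u v)) = ?p (lbracket L x y)"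
      using self[OF x] self[OF y] by blast
    then show ?thesis by (simp add: lie_quotient_def)
  qed
  have C: "lcarrier ?Q = ?p ` lcarrier L" and Z: "lzero ?Q = ?p (lzero L)"
    by (simp_all add: lie_quotient_def)
  show "lie_algebra ?Q"
  proof
    fix X assume "X \<in> lcarrier ?Q"
    then show "\<exists>Y\<in>lcarrier ?Q. ladd ?Q X Y = lzero ?Q"
      unfolding C Z using A add_inverse by (smt (verit) image_iff)
  next
    fix X Y assume "X \<in> lcarrier ?Q" "Y \<in> lcarrier ?Q"
    then obtain x y where "X = ?p x" "Y = ?p y" "x \<in> lcarrier L" "y \<in> lcarrier L"
      unfolding C by blast
    then show "ladd ?Q X Y = ladd ?Q Y X" by (simp add: A add_comm[of x y])
  qed (auto simp: C Z A S B cl add_zero add_assoc smult_add add_smult smult_smult smult_one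
      bracket_add_left bracket_add_right bracket_smult_left bracket_smult_right bracket_self jacobi)
qed

context unital_algebra
begin

lemma linear_iff_scale:
  "Vector_Spaces.linear scale scale \<delta> \<longleftrightarrow>
     (\<forall>a b. \<delta> (a + b) = \<delta> a + \<delta> b) \<and> (\<forall>c a. \<delta> (scale c a) = scale c (\<delta> a))"
  by (auto simp: Vector_Spaces.linear_iff vector_space_axioms)

lemma Der_diff: "\<delta> (a - b) = \<delta> a - \<delta> b" and Der_zero: "\<delta> 0 = 0" if "\<delta> \<in> Der scale"
proof -
  have add: "\<delta> (a + b) = \<delta> a + \<delta> b" for a b using that by (simp add: Der_def linear_iff_scale)
  show "\<delta> 0 = 0" using add[of 0 0] by simp
  show "\<delta> (a - b) = \<delta> a - \<delta> b" using add[of "a - b" b] by (simp add: algebra_simps)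
qed

lemma Der_lie_algebra: "lie_algebra (Der_lie scale)"
proof
  fix \<delta> assume d: "\<delta> \<in> lcarrier (Der_lie scale)"
  show "\<exists>\<epsilon>\<in>lcarrier (Der_lie scale). ladd (Der_lie scale) \<delta> \<epsilon> = lzero (Der_lie scale)"
    using d
    by (intro bexI[of _ "\<lambda>a. - \<delta> a"]) (auto simp: Der_lie_def Der_def linear_iff_scale algebra_simps)
next
  fix \<delta> \<epsilon> assume "\<delta> \<in> lcarrier (Der_lie scale)" "\<epsilon> \<in> lcarrier (Der_lie scale)"
  then have D: "\<delta> \<in> Der scale" "\<epsilon> \<in> Der scale" by (simp_all add: Der_lie_def)
  then show "lbracket (Der_lie scale) \<delta> \<epsilon> \<in> lcarrier (Der_lie scale)"
    by (simp add: Der_lie_def Der_def linear_iff_scale algebra_simps scale_right_diff_distrib)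
next
  fix \<delta> \<epsilon> \<eta>
  assume "\<delta> \<in> lcarrier (Der_lie scale)" "\<epsilon> \<in> lcarrier (Der_lie scale)"
    "\<eta> \<in> lcarrier (Der_lie scale)"
  then have "\<delta> \<in> Der scale" "\<epsilon> \<in> Der scale" "\<eta> \<in> Der scale" by (simp_all add: Der_lie_def)
  then show "ladd (Der_lie scale) (lbracket (Der_lie scale) \<delta> (lbracket (Der_lie scale) \<epsilon> \<eta>))
     (ladd (Der_lie scale) (lbracket (Der_lie scale) \<epsilon> (lbracket (Der_lie scale) \<eta> \<delta>))
       (lbracket (Der_lie scale) \<eta> (lbracket (Der_lie scale) \<delta> \<epsilon>))) = lzero (Der_lie scale)"
    by (simp add: Der_lie_def Der_diff)
qed (auto simp: Der_lie_def Der_def linear_iff_scale algebra_simps scale_left_distrib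
    scale_right_distrib scale_right_diff_distrib scale_mult_left scale_mult_right)

lemma InnDer_subset: "InnDer \<subseteq> Der scale"
  by (auto simp: InnDer_def Der_def linear_iff_scale algebra_simps scale_right_diff_distrib
      scale_mult_left scale_mult_right)

lemma InnDer_ideal:
  "lzero (Der_lie scale) \<in> InnDer"
  "i \<in> InnDer \<Longrightarrow> j \<in> InnDer \<Longrightarrow> ladd (Der_lie scale) i j \<in> InnDer"
  "i \<in> InnDer \<Longrightarrow> \<exists>j\<in>InnDer. ladd (Der_lie scale) i j = lzero (Der_lie scale)"
  "i \<in> InnDer \<Longrightarrow> lsmult (Der_lie scale) c i \<in> InnDer"
  "\<delta> \<in> lcarrier (Der_lie scale) \<Longrightarrow> i \<in> InnDer \<Longrightarrow>
     lbracket (Der_lie scale) \<delta> i \<in> InnDer \<and> lbracket (Der_lie scale) i \<delta> \<in> InnDer"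
proof -
  have I: "(\<lambda>a. x * a - a * x) \<in> InnDer" for x :: 'a by (auto simp: InnDer_def)
  show "lzero (Der_lie scale) \<in> InnDer"
    using I[of 0] by (simp add: Der_lie_def)
  show "lsmult (Der_lie scale) c i \<in> InnDer" if i: "i \<in> InnDer"
  proof -
    obtain x where "i = (\<lambda>a. x * a - a * x)" using i by (auto simp: InnDer_def)
    then show ?thesis using I[of "scale c x"]
      by (simp add: Der_lie_def scale_right_diff_distrib scale_mult_left scale_mult_right)
  qed
  show "ladd (Der_lie scale) i j \<in> InnDer" if ij: "i \<in> InnDer" "j \<in> InnDer"
  proof -
    obtain x y where "i = (\<lambda>a. x * a - a * x)" "j = (\<lambda>a. y * a - a * y)"
      using ij by (auto simp: InnDer_def)
    then show ?thesis using I[of "x + y"] by (simp add: Der_lie_def algebra_simps)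
  qed
  show "\<exists>j\<in>InnDer. ladd (Der_lie scale) i j = lzero (Der_lie scale)" if i: "i \<in> InnDer"
  proof -
    obtain x where "i = (\<lambda>a. x * a - a * x)" using i by (auto simp: InnDer_def)
    then show ?thesis
      by (intro bexI[OF _ I[of "- x"]]) (auto simp: Der_lie_def)
  qed
  show "lbracket (Der_lie scale) \<delta> i \<in> InnDer \<and> lbracket (Der_lie scale) i \<delta> \<in> InnDer"
    if di: "\<delta> \<in> lcarrier (Der_lie scale)" "i \<in> InnDer"
  proof -
    obtain x where i: "i = (\<lambda>a. x * a - a * x)" using di by (auto simp: InnDer_def)
    have D: "\<delta> \<in> Der scale" using di by (simp add: Der_lie_def)
    then have leib: "\<delta> (a * b) = \<delta> a * b + a * \<delta> b" for a b by (simp add: Der_def)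
    have "lbracket (Der_lie scale) \<delta> i = (\<lambda>a. \<delta> x * a - a * \<delta> x)"
      "lbracket (Der_lie scale) i \<delta> = (\<lambda>a. (- \<delta> x) * a - a * (- \<delta> x))"
      using D by (auto simp: Der_lie_def i Der_diff leib algebra_simps)
    then show ?thesis by (simp only: I simp_thms)
  qed
qed

lemmas HH1_facts = lie_algebra.quotient_lie_algebra[OF Der_lie_algebra,
    of InnDer, OF _ InnDer_ideal, folded HH1_def HH1_class_def]

lemma InnDer_subset_carrier: "InnDer \<subseteq> lcarrier (Der_lie scale)"
  using InnDer_subset by (simp add: Der_lie_def)

lemma HH1_lie_algebra: "lie_algebra (HH1 scale)"
  by (rule HH1_facts(1)[OF InnDer_subset_carrier])

lemma HH1_act_class:
  assumes "z \<in> center" shows "HH1_act (HH1_class scale \<delta>) z = \<delta> z"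
proof -
  have "(\<lambda>\<epsilon>. \<epsilon> z) ` HH1_class scale \<delta> = {\<delta> z}"
    using assms InnDer_ideal(1)
    by (force simp: HH1_class_def lcoset_def Der_lie_def image_image InnDer_def center_def)
  then show ?thesis by (simp add: HH1_act_def)
qed

lemma Der_center:
  assumes "\<delta> \<in> Der scale" "z \<in> center" shows "\<delta> z \<in> center"
proof -
  have leib: "\<delta> (a * b) = \<delta> a * b + a * \<delta> b" for a b using assms by (simp add: Der_def)
  have "\<delta> z * a = a * \<delta> z" for a
  proof -
    have "\<delta> (z * a) = \<delta> (a * z)" using assms by (simp add: center_def)
    moreover have "z * \<delta> a = \<delta> a * z" using assms by (simp add: center_def)
    ultimately show ?thesis by (simp add: leib)
  qed
  then show ?thesis by (simp add: center_def)
qed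

lemma center_lie_module: "lie_module (HH1 scale) scale center HH1_act"
proof -
  interpret H: lie_algebra "HH1 scale" by (rule HH1_lie_algebra)
  have car: "lcarrier (HH1 scale) = HH1_class scale ` Der scale"
    by (simp add: HH1_def lie_quotient_def HH1_class_def[abs_def] Der_lie_def)
  have D: "lcarrier (Der_lie scale) = Der scale" by (simp add: Der_lie_def)
  note F = HH1_facts(2-4)[OF InnDer_subset_carrier, unfolded D]
  have cen: "x + y \<in> center" "scale c x \<in> center" if "x \<in> center" "y \<in> center" for x y c
    using that by (simp_all add: center_def algebra_simps scale_mult_left scale_mult_right)
  have z: "0 \<in> center" by (simp add: center_def)
  have sub: "subspace center" unfolding subspace_def using cen z by blast
  show ?thesis
    by unfold_locales
      (use sub in \<open>auto simp: car F HH1_act_class Der_center cen,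
        auto simp: Der_lie_def HH1_act_class Der_center Der_def linear_iff_scale\<close>)
qed

end

lemma (in lie_module) CE_coboundaries_1_subset:
  "CE_coboundaries L scale M act 1 \<subseteq> CE_cocycles L scale M act 1"
proof
  fix \<beta> assume "\<beta> \<in> CE_coboundaries L scale M act 1"
  then obtain \<omega> where w: "\<omega> \<in> CE_cochains L scale M 0" and b: "\<beta> = CE_d L scale act \<omega>"
    by (auto simp: CE_coboundaries_def)
  define m where "m = \<omega> []"
  have m: "m \<in> M" and w0: "\<And>xs. xs \<noteq> [] \<Longrightarrow> \<omega> xs = 0"
    using w by (auto simp: CE_cochains_def m_def)
  have a0: "act x 0 = 0" if "x \<in> lcarrier L" for x
    using act_add[OF that, of 0 0] subspace by (simp add: subspace_def)
  have len: "length (nths xs (- {i})) = length xs - 1" if "i < length xs" for xs :: "'g list" and i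
  proof -
    have "{j. j < length xs \<and> j \<noteq> i} = {..<length xs} - {i}" by auto
    then show ?thesis using that by (simp add: length_nths)
  qed
  have b1: "\<beta> [x] = act x m" if "x \<in> lcarrier L" for x
    using that by (simp add: b CE_d_def m_def)
  have b0: "\<beta> xs = 0" if "\<not> (length xs = 1 \<and> set xs \<subseteq> lcarrier L)" for xs
  proof (cases "set xs \<subseteq> lcarrier L")
    case True
    then have l: "length xs \<noteq> 1" using that by blast
    have "act (xs ! i) (\<omega> (nths xs (- {i}))) = 0" if i: "i < length xs" for i
    proof -
      have "nths xs (- {i}) \<noteq> []" using len[OF i] l i by (metis One_nat_def Suc_pred
            gr_implies_not0 length_0_conv length_greater_0_conv)
      then show ?thesis using w0 a0 True i by (simp add: subset_iff)
    qed
    then show ?thesis by (simp add: b CE_d_def w0)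
  qed (simp add: b CE_d_def)
  have "\<beta> \<in> CE_cochains L scale M 1"
    unfolding CE_cochains_def lie_linear_def
    using b0 by (auto simp: length_Suc_conv b1 m act_closed add_act smult_act add_closed smult_closed)
  moreover have "CE_d L scale act \<beta> xs = 0" for xs
  proof (cases "length xs = 2 \<and> set xs \<subseteq> lcarrier L")
    case True
    then obtain x y where xs: "xs = [x, y]" "x \<in> lcarrier L" "y \<in> lcarrier L"
      by (auto simp: length_Suc_conv numeral_2_eq_2)
    then show ?thesis
      by (simp add: CE_d_def nths_Cons b1 bracket_closed bracket_act m lessThan_Suc
          numeral_2_eq_2)
  next
    case False
    show ?thesis
    proof (cases "set xs \<subseteq> lcarrier L")
      case True
      then have l: "length xs \<noteq> 2" using False by blast
      have 1: "act (xs ! i) (\<beta> (nths xs (- {i}))) = 0" if i: "i < length xs" for i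
      proof -
        have "length (nths xs (- {i})) \<noteq> 1" using len[OF i] l i by linarith
        then show ?thesis using b0 a0 True i by (simp add: subset_iff)
      qed
      have 2: "\<beta> (lbracket L (xs ! i) (xs ! j) # nths xs (- {i, j})) = 0"
        if ij: "i < j" "j < length xs" for i j
      proof -
        have "{k. k < length xs \<and> k \<noteq> i \<and> k \<noteq> j} = {..<length xs} - {i, j}" by auto
        then have "length (nths xs (- {i, j})) = length xs - 2"
          using ij by (simp add: length_nths card_Diff_subset)
        then show ?thesis using l ij by (intro b0) auto
      qed
      show ?thesis using 1 2 by (simp add: CE_d_def)
    qed (simp add: CE_d_def)
  qed
  ultimately show "\<beta> \<in> CE_cocycles L scale M act 1" by (auto simp: CE_cocycles_def)
qed

end

theory Submission
  imports Defs
begin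

text \<open>
  Write \<open>\<lambda> a = form a 1\<close>. The divergence of \<open>\<delta>\<close> represents the functional \<open>\<lambda> \<circ> \<delta>\<close>, that is,
  \<open>form a (div \<delta>) = \<lambda> (\<delta> a)\<close>. Symmetry of the form says that \<open>\<lambda>\<close> is a trace. Hence \<open>\<lambda> \<circ> \<delta>\<close>, which
  sends \<open>a * b\<close> to \<open>\<lambda> (\<delta> a * b) + \<lambda> (a * \<delta> b)\<close>, is a trace as well, which makes \<open>div \<delta>\<close> central;
  and \<open>\<lambda>\<close> vanishes on commutators, so \<open>div\<close> kills inner derivations. The defining identity of
  \<open>div \<delta>\<close> at \<open>b = div \<epsilon>\<close> computes \<open>\<lambda> (\<epsilon> (\<delta> a))\<close> as \<open>form a (div \<epsilon> * div \<delta> - \<delta> (div \<epsilon>))\<close>;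
  antisymmetrising in \<open>\<delta>\<close> and \<open>\<epsilon>\<close> cancels the product and leaves the cocycle identity.
\<close>

text \<open>At \<open>[x, y]\<close> the differential is
  \<open>act x (f y) - act y (f x) - f (lbracket L x y)\<close>, which the cocycle identity makes
  zero. On lists of any other length each summand is a default zero.\<close>

lemma (in lie_module) CE_1_cochain_cocycle:
  assumes "lie_1_cocycle L scale M act f"
  shows "CE_1_cochain L f \<in> CE_cocycles L scale M act 1"
proof -
  let ?\<omega> = "CE_1_cochain L f"
  have fM: "\<And>x. x \<in> lcarrier L \<Longrightarrow> f x \<in> M"
    and fadd: "\<And>x y. x \<in> lcarrier L \<Longrightarrow> y \<in> lcarrier L \<Longrightarrow> f (ladd L x y) = f x + f y"
    and fscale: "\<And>c x. x \<in> lcarrier L \<Longrightarrow> f (lsmult L c x) = scale c (f x)"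
    and fbr: "\<And>x y. x \<in> lcarrier L \<Longrightarrow> y \<in> lcarrier L \<Longrightarrow>
      f (lbracket L x y) = act x (f y) - act y (f x)"
    using assms by (auto simp: lie_1_cocycle_def lie_linear_def)
  have w1: "?\<omega> [x] = f x" if "x \<in> lcarrier L" for x
    using that by (simp add: CE_1_cochain_def)
  have w0: "?\<omega> xs = 0" if "\<not> (length xs = 1 \<and> set xs \<subseteq> lcarrier L)" for xs
    using that by (auto simp: CE_1_cochain_def split: list.splits)
  \<comment> \<open>In the differential the action is also applied to the default value
    \<open>0\<close> of the cochain.\<close>
  have a0: "act x 0 = 0" if "x \<in> lcarrier L" for x
    using act_add[OF that, of 0 0] subspace by (simp add: subspace_def)
  have "?\<omega> \<in> CE_cochains L scale M 1"
    unfolding CE_cochains_def lie_linear_def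
    using w0 by (auto simp: length_Suc_conv w1 fM fadd fscale add_closed smult_closed)
  moreover have "CE_d L scale act ?\<omega> xs = 0" for xs
  proof (cases "set xs \<subseteq> lcarrier L")
    case sub: True
    show ?thesis
    proof (cases "length xs = 2")
      case True
      then obtain x y where "xs = [x, y]" "x \<in> lcarrier L" "y \<in> lcarrier L"
        using sub by (auto simp: length_Suc_conv numeral_2_eq_2)
      then show ?thesis
        by (simp add: CE_d_def nths_Cons w1 bracket_closed fbr lessThan_Suc numeral_2_eq_2)
    next
      case l: False
      have 1: "act (xs ! i) (?\<omega> (nths xs (- {i}))) = 0" if i: "i < length xs" for i
      proof -
        have "{j. j < length xs \<and> j \<noteq> i} = {..<length xs} - {i}" by auto
        then have "length (nths xs (- {i})) = length xs - 1"
          using i by (simp add: length_nths)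
        then have "length (nths xs (- {i})) \<noteq> 1" using l i by linarith
        then show ?thesis using w0 a0 sub i by (simp add: subset_iff)
      qed
      \<comment> \<open>From \<open>i < j\<close> the length is at least 2, so
        \<open>length xs - 2\<close> is not truncated and the bracketed list has length 1 only if
        \<open>length xs = 2\<close>.\<close>
      have 2: "?\<omega> (lbracket L (xs ! i) (xs ! j) # nths xs (- {i, j})) = 0"
        if ij: "i < j" "j < length xs" for i j
      proof -
        have "{k. k < length xs \<and> k \<noteq> i \<and> k \<noteq> j} = {..<length xs} - {i, j}" by auto
        then have "length (nths xs (- {i, j})) = length xs - 2"
          using ij by (simp add: length_nths card_Diff_subset)
        then show ?thesis using l ij by (intro w0) auto
      qed
      show ?thesis using 1 2 by (simp add: CE_d_def)
    qed
  qed (simp add: CE_d_def)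
  ultimately show ?thesis by (auto simp: CE_cocycles_def)
qed

context unital_algebra
begin

lemma HH1_carrier: "lcarrier (HH1 scale) = HH1_class scale ` Der scale"
  by (simp add: HH1_def lie_quotient_def HH1_class_def[abs_def] Der_lie_def)

lemma Der_add: "\<delta> \<in> Der scale \<Longrightarrow> \<epsilon> \<in> Der scale \<Longrightarrow> (\<lambda>a. \<delta> a + \<epsilon> a) \<in> Der scale"
  and Der_scale: "\<delta> \<in> Der scale \<Longrightarrow> (\<lambda>a. scale c (\<delta> a)) \<in> Der scale"
  and Der_bracket: "\<delta> \<in> Der scale \<Longrightarrow> \<epsilon> \<in> Der scale \<Longrightarrow> (\<lambda>a. \<delta> (\<epsilon> a) - \<epsilon> (\<delta> a)) \<in> Der scale"
  using lie_algebra.add_closed[OF Der_lie_algebra, of \<delta> \<epsilon>]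
    lie_algebra.smult_closed[OF Der_lie_algebra, of \<delta> c]
    lie_algebra.bracket_closed[OF Der_lie_algebra, of \<delta> \<epsilon>]
  by (simp_all add: Der_lie_def)

lemma HH1_class_add: "\<delta> \<in> Der scale \<Longrightarrow> \<epsilon> \<in> Der scale \<Longrightarrow>
    ladd (HH1 scale) (HH1_class scale \<delta>) (HH1_class scale \<epsilon>) = HH1_class scale (\<lambda>a. \<delta> a + \<epsilon> a)"
  and HH1_class_scale: "\<delta> \<in> Der scale \<Longrightarrow>
    lsmult (HH1 scale) c (HH1_class scale \<delta>) = HH1_class scale (\<lambda>a. scale c (\<delta> a))"
  and HH1_class_bracket: "\<delta> \<in> Der scale \<Longrightarrow> \<epsilon> \<in> Der scale \<Longrightarrow>
    lbracket (HH1 scale) (HH1_class scale \<delta>) (HH1_class scale \<epsilon>) =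
      HH1_class scale (\<lambda>a. \<delta> (\<epsilon> a) - \<epsilon> (\<delta> a))"
  using HH1_facts(2)[OF InnDer_subset_carrier, of \<delta> \<epsilon>] HH1_facts(3)[OF InnDer_subset_carrier, of \<delta> c]
    HH1_facts(4)[OF InnDer_subset_carrier, of \<delta> \<epsilon>]
  by (simp_all add: Der_lie_def)

end

context frobenius_algebra
begin

lemma nakayama_div_eq:
  assumes "\<delta> \<in> Der scale"
  shows "form (\<delta> a) b + form a (\<delta> b) = form a (b * nakayama_div form \<delta>)"
  using theI'[OF nakayama_div_ex1[OF assms]] unfolding nakayama_div_def by blast

text \<open>At \<open>b = 1\<close> the second term of the defining identity drops out, since
  \<open>\<delta> 1 = 0\<close>. With \<open>form_right_cancel\<close>, later identities between
  divergences reduce to identities for the functional \<open>form _ 1\<close>.\<close>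

lemma form_nakayama_div:
  assumes "\<delta> \<in> Der scale" shows "form a (nakayama_div form \<delta>) = form (\<delta> a) 1"
proof -
  have "\<delta> (1 * 1) = \<delta> 1 * 1 + 1 * \<delta> 1" using assms unfolding Der_def by blast
  then have "\<delta> 1 = 0" by simp
  then show ?thesis using nakayama_div_eq[OF assms, of a 1] by (simp add: form_simps)
qed

lemma nakayama_div_add:
  assumes "\<delta> \<in> Der scale" "\<epsilon> \<in> Der scale"
  shows "nakayama_div form (\<lambda>a. \<delta> a + \<epsilon> a) = nakayama_div form \<delta> + nakayama_div form \<epsilon>"
  by (rule form_right_cancel) (simp add: form_nakayama_div form_simps Der_add assms)

lemma nakayama_div_scale:
  assumes "\<delta> \<in> Der scale"
  shows "nakayama_div form (\<lambda>a. scale c (\<delta> a)) = scale c (nakayama_div form \<delta>)"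
  by (rule form_right_cancel) (simp add: form_nakayama_div form_simps Der_scale assms)

text \<open>Without symmetry of the form, divergences are not known to be central, so the commutator
  of \<open>d\<close> and \<open>e\<close> stays in the formula.\<close>

lemma nakayama_div_bracket:
  assumes D: "\<delta> \<in> Der scale" "\<epsilon> \<in> Der scale"
  defines "d \<equiv> nakayama_div form \<delta>" and "e \<equiv> nakayama_div form \<epsilon>"
  shows "nakayama_div form (\<lambda>a. \<delta> (\<epsilon> a) - \<epsilon> (\<delta> a)) = \<delta> e - \<epsilon> d + (d * e - e * d)"
proof (rule form_right_cancel)
  fix a
  \<comment> \<open>The left side is \<open>form (\<epsilon> a) d\<close>, to which the defining
    identity of \<open>e\<close> applies with \<open>b = d\<close>.\<close>
  have "form (\<delta> (\<epsilon> a)) 1 = form a (d * e) - form a (\<epsilon> d)"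
    using form_nakayama_div[OF D(1), of "\<epsilon> a"] nakayama_div_eq[OF D(2), of a d]
    unfolding d_def e_def by (simp add: eq_diff_eq)
  moreover have "form (\<epsilon> (\<delta> a)) 1 = form a (e * d) - form a (\<delta> e)"
    using form_nakayama_div[OF D(2), of "\<delta> a"] nakayama_div_eq[OF D(1), of a e]
    unfolding d_def e_def by (simp add: eq_diff_eq)
  ultimately show "form a (nakayama_div form (\<lambda>a. \<delta> (\<epsilon> a) - \<epsilon> (\<delta> a))) =
      form a (\<delta> e - \<epsilon> d + (d * e - e * d))"
    by (simp add: form_nakayama_div[OF Der_bracket[OF D]] form_simps)
qed

end

locale symmetric_frobenius_algebra = frobenius_algebra +
  assumes form_sym: "form a b = form b a"
begin

lemma nakayama_automorphism_eq_id: "nakayama_automorphism scale form = id"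
  unfolding nakayama_automorphism_def
proof (rule the1_equality[OF nakayama_automorphism_ex1])
  show "algebra_automorphism scale id \<and> (\<forall>a b. form a b = form b (id a))"
    by (auto simp: algebra_automorphism_def linear_iff_scale form_sym)
qed

lemma form_trace: "form (a * b) 1 = form (b * a) 1"
  using form_sym[of a b] by (simp add: form_assoc)

lemma nakayama_div_center:
  assumes D: "\<delta> \<in> Der scale" shows "nakayama_div form \<delta> \<in> center"
proof -
  let ?d = "nakayama_div form \<delta>"
  have leib: "\<delta> (a * b) = \<delta> a * b + a * \<delta> b" for a b using D by (simp add: Der_def)
  have "?d * c = c * ?d" for c
  proof (rule form_right_cancel)
    fix a
    \<comment> \<open>Symmetry rotates \<open>c\<close> to the front of the product
      \<open>a * ?d * c\<close>.\<close>
    have "form a (?d * c) = form (c * a) ?d"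
      using form_sym[of c "a * ?d"] by (simp add: form_assoc)
    \<comment> \<open>After the Leibniz rule the summands match crosswise: the trace property
      exchanges \<open>\<delta> c\<close> with \<open>a\<close>, and \<open>c\<close> with
      \<open>\<delta> a\<close>.\<close>
    also have "\<dots> = form (a * c) ?d"
      unfolding form_nakayama_div[OF D] leib form_simps
      using form_trace[of "\<delta> c" a] form_trace[of c "\<delta> a"] by (simp add: add.commute)
    finally show "form a (?d * c) = form a (c * ?d)" by (simp add: form_assoc)
  qed
  then show ?thesis by (simp add: center_def)
qed

lemma nakayama_div_InnDer:
  assumes "\<delta> \<in> InnDer" shows "nakayama_div form \<delta> = 0"
proof (rule form_right_cancel)
  fix a
  obtain x where x: "\<delta> = (\<lambda>a. x * a - a * x)" using assms by (auto simp: InnDer_def)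
  have "\<delta> \<in> Der scale" using assms InnDer_subset by blast
  then show "form a (nakayama_div form \<delta>) = form a 0"
    using form_trace[of x a] by (simp add: form_nakayama_div x form_simps)
qed

text \<open>Additivity and vanishing on \<open>InnDer\<close> make the divergence constant on each
  coset.\<close>

lemma HH1_div_class:
  assumes D: "\<delta> \<in> Der scale" shows "HH1_div form (HH1_class scale \<delta>) = nakayama_div form \<delta>"
proof -
  have "nakayama_div form (\<lambda>a. \<delta> a + i a) = nakayama_div form \<delta>" if "i \<in> InnDer" for i
    using that InnDer_subset nakayama_div_InnDer[OF that] by (subst nakayama_div_add[OF D]) auto
  \<comment> \<open>This keeps the image from being empty, so that it is a singleton and
    \<open>the_elem\<close> returns its element.\<close>
  moreover have "(InnDer :: ('b \<Rightarrow> 'b) set) \<noteq> {}" using InnDer_ideal(1) by auto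
  ultimately have "nakayama_div form ` HH1_class scale \<delta> = {nakayama_div form \<delta>}"
    by (auto simp: HH1_class_def lcoset_def Der_lie_def image_image)
  then show ?thesis by (simp add: HH1_div_def)
qed

lemma HH1_div_linear: "lie_linear (HH1 scale) scale center (HH1_div form)"
  unfolding lie_linear_def HH1_carrier
proof (intro conjI ballI allI; clarify)
  fix \<delta> \<epsilon> assume D: "\<delta> \<in> Der scale" "\<epsilon> \<in> Der scale"
  show "HH1_div form (ladd (HH1 scale) (HH1_class scale \<delta>) (HH1_class scale \<epsilon>)) =
      HH1_div form (HH1_class scale \<delta>) + HH1_div form (HH1_class scale \<epsilon>)"
    by (simp only: HH1_class_add[OF D] HH1_div_class D Der_add[OF D] nakayama_div_add[OF D])
next
  fix \<delta> c assume D: "\<delta> \<in> Der scale"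
  show "HH1_div form (HH1_class scale \<delta>) \<in> center"
    by (simp only: HH1_div_class D nakayama_div_center)
  show "HH1_div form (lsmult (HH1 scale) c (HH1_class scale \<delta>)) =
      scale c (HH1_div form (HH1_class scale \<delta>))"
    by (simp only: HH1_class_scale HH1_div_class D Der_scale nakayama_div_scale)
qed

text \<open>Centrality of divergences enters twice: it removes the commutator from
  \<open>nakayama_div_bracket\<close>, and it lets \<open>HH1_act\<close> be evaluated on any
  representative.\<close>

lemma HH1_div_cocycle: "lie_1_cocycle (HH1 scale) scale center HH1_act (HH1_div form)"
  unfolding lie_1_cocycle_def HH1_carrier
proof (intro conjI HH1_div_linear ballI; clarify)
  fix \<delta> \<epsilon> assume D: "\<delta> \<in> Der scale" "\<epsilon> \<in> Der scale"
  let ?d = "nakayama_div form \<delta>" and ?e = "nakayama_div form \<epsilon>"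
  have "HH1_div form (lbracket (HH1 scale) (HH1_class scale \<delta>) (HH1_class scale \<epsilon>)) =
      \<delta> ?e - \<epsilon> ?d + (?d * ?e - ?e * ?d)"
    by (simp only: HH1_class_bracket[OF D] HH1_div_class[OF Der_bracket[OF D]]
        nakayama_div_bracket[OF D])
  also have "?d * ?e - ?e * ?d = 0" using nakayama_div_center[OF D(1)] by (simp add: center_def)
  finally show "HH1_div form (lbracket (HH1 scale) (HH1_class scale \<delta>) (HH1_class scale \<epsilon>)) =
      HH1_act (HH1_class scale \<delta>) (HH1_div form (HH1_class scale \<epsilon>)) -
      HH1_act (HH1_class scale \<epsilon>) (HH1_div form (HH1_class scale \<delta>))"
    by (simp add: HH1_div_class D HH1_act_class nakayama_div_center)
qed

end

theorem lemma47:
  fixes scale :: "'k::field \<Rightarrow> 'a::{ring, monoid_mult} \<Rightarrow> 'a"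
    and form :: "'a \<Rightarrow> 'a \<Rightarrow> 'k"
  assumes "frobenius_algebra scale form"
    and "\<forall>a b. form a b = form b a"
  shows "nakayama_automorphism scale form = id \<and>
    (\<forall>\<delta>\<in>Der scale. nakayama_div form \<delta> \<in> center) \<and>
    (\<forall>\<delta>\<in>InnDer. nakayama_div form \<delta> = 0) \<and>
    (\<forall>\<delta>\<in>Der scale. HH1_div form (HH1_class scale \<delta>) = nakayama_div form \<delta>) \<and>
    lie_linear (HH1 scale) scale center (HH1_div form) \<and>
    lie_1_cocycle (HH1 scale) scale center HH1_act (HH1_div form) \<and>
    CE_1_cochain (HH1 scale) (HH1_div form) \<in> CE_cocycles (HH1 scale) scale center HH1_act 1 \<and>
    Div_class scale form \<in> CE_cohomology (HH1 scale) scale center HH1_act 1"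
proof -
  interpret frobenius_algebra scale form by fact
  interpret symmetric_frobenius_algebra scale form by unfold_locales (use assms(2) in blast)
  have "CE_1_cochain (HH1 scale) (HH1_div form) \<in> CE_cocycles (HH1 scale) scale center HH1_act 1"
    by (rule lie_module.CE_1_cochain_cocycle[OF center_lie_module HH1_div_cocycle])
  then show ?thesis
    unfolding Div_class_def CE_cohomology_def
    using nakayama_automorphism_eq_id nakayama_div_center nakayama_div_InnDer HH1_div_class
      HH1_div_linear HH1_div_cocycle by blast
qed

end
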